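(* Let $(X,\to,0,1)$ be an implicative-orthomodular algebra. The following hold for all $x,y,z\in X$: (1) $(x\to y)\Cup y=x\to y$; (2) $(x\to y)\to (y\Cap x)=x$; (3) $x\to (y\Cap x)=x\to y$; (4) $(x\Cup y)\to (x\to y)^*=y^*$; (5) $x\Cap ((y\to x)\Cap (z\to x))=x$; (6) $x\le y$ if and only if $y\Cap x=x$; (7) $x\le_Q y$ and $y\le x$ imply $x=y$; (8) $x\Cap y\le_Q y\le_Q x\Cup y$; (9) $(x\Cup y)\to y=x\to y$; (10) $x\Cap y\le_Q x\to y$ and $y\Cap x\le_Q x\to y$.
   Context: A BE algebra is an algebra $(X,\to,1)$ of type $(2,0)$ such that for all $x,y,z\in X$: $x\to x=1$; $x\to 1=1$; $1\to x=x$; $x\to(y\to z)=y\to(x\to z)$. Put $x\le y$ iff $x\to y=1$. It is bounded if there is $0\in X$ with $0\le x$ for all $x\in X$; then $x^*:=x\to 0$. It is involutive if it is bounded and $x^{**}=x$ for all $x$. In an involutive BE algebra $(X,\to,0,1)$ define $x\Cup y:=(x\to y)\to y$, $x\Cap y:=((x^*\to y^* )\to y^* )^*$, and $x\le_Q y$ iff $x=x\Cap y$. An implicative-orthomodular algebra is an involutive BE algebra satisfying $x\Cap(y\to x)=x$ for all $x,y\in X$. *)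

theory Defs
  imports "HOL-Algebra.Congruence"
begin

section \<open>BE algebras\<close>

record 'a be_algebra = "'a partial_object" +
  imp :: "'a \<Rightarrow> 'a \<Rightarrow> 'a"  (infixr \<open>\<leadsto>\<index>\<close> 65)
  one :: "'a"  (\<open>\<one>\<index>\<close>)

record 'a bounded_be_algebra = "'a be_algebra" +
  zero :: "'a"  (\<open>\<zero>\<index>\<close>)

definition be_le :: "('a, 'm) be_algebra_scheme \<Rightarrow> 'a \<Rightarrow> 'a \<Rightarrow> bool"  (infix \<open>\<preceq>\<index>\<close> 50)
  where "x \<preceq>\<^bsub>X\<^esub> y \<longleftrightarrow> x \<leadsto>\<^bsub>X\<^esub> y = \<one>\<^bsub>X\<^esub>"

definition neg :: "('a, 'm) bounded_be_algebra_scheme \<Rightarrow> 'a \<Rightarrow> 'a"  (\<open>\<sim>\<index>_\<close> [81] 80)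
  where "\<sim>\<^bsub>X\<^esub>x = x \<leadsto>\<^bsub>X\<^esub> \<zero>\<^bsub>X\<^esub>"

text \<open>
  The operations \<open>\<squnion>\<close> and \<open>\<sqinter>\<close> below are the (in general non-commutative) operations
  usually written as double cup and double cap; they are not lattice operations.
\<close>

definition qjoin :: "('a, 'm) be_algebra_scheme \<Rightarrow> 'a \<Rightarrow> 'a \<Rightarrow> 'a"  (infixl \<open>\<squnion>\<index>\<close> 70)
  where "x \<squnion>\<^bsub>X\<^esub> y = (x \<leadsto>\<^bsub>X\<^esub> y) \<leadsto>\<^bsub>X\<^esub> y"

definition qmeet :: "('a, 'm) bounded_be_algebra_scheme \<Rightarrow> 'a \<Rightarrow> 'a \<Rightarrow> 'a"  (infixl \<open>\<sqinter>\<index>\<close> 70)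
  where "x \<sqinter>\<^bsub>X\<^esub> y = \<sim>\<^bsub>X\<^esub>((\<sim>\<^bsub>X\<^esub>x \<leadsto>\<^bsub>X\<^esub> \<sim>\<^bsub>X\<^esub>y) \<leadsto>\<^bsub>X\<^esub> \<sim>\<^bsub>X\<^esub>y)"

definition q_le :: "('a, 'm) bounded_be_algebra_scheme \<Rightarrow> 'a \<Rightarrow> 'a \<Rightarrow> bool"  (infix \<open>\<preceq>\<^sub>Q\<index>\<close> 50)
  where "x \<preceq>\<^sub>Q\<^bsub>X\<^esub> y \<longleftrightarrow> x = x \<sqinter>\<^bsub>X\<^esub> y"

locale BE_algebra =
  fixes X (structure)
  assumes imp_closed: "\<lbrakk>x \<in> carrier X; y \<in> carrier X\<rbrakk> \<Longrightarrow> x \<leadsto> y \<in> carrier X"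
    and one_closed: "\<one> \<in> carrier X"
    and imp_self: "x \<in> carrier X \<Longrightarrow> x \<leadsto> x = \<one>"
    and imp_one: "x \<in> carrier X \<Longrightarrow> x \<leadsto> \<one> = \<one>"
    and one_imp: "x \<in> carrier X \<Longrightarrow> \<one> \<leadsto> x = x"
    and exchange: "\<lbrakk>x \<in> carrier X; y \<in> carrier X; z \<in> carrier X\<rbrakk> \<Longrightarrow>
      x \<leadsto> (y \<leadsto> z) = y \<leadsto> (x \<leadsto> z)"

locale bounded_BE_algebra = BE_algebra X for X (structure) +
  assumes zero_closed: "\<zero> \<in> carrier X"
    and zero_le: "x \<in> carrier X \<Longrightarrow> \<zero> \<preceq> x"

locale involutive_BE_algebra = bounded_BE_algebra X for X (structure) +
  assumes neg_neg: "x \<in> carrier X \<Longrightarrow> \<sim>(\<sim>x) = x"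

locale implicative_orthomodular_algebra = involutive_BE_algebra X for X (structure) +
  assumes implicative_orthomodular:
    "\<lbrakk>x \<in> carrier X; y \<in> carrier X\<rbrakk> \<Longrightarrow> x \<sqinter> (y \<leadsto> x) = x"

text \<open>
  A misprint in the source: it lists the law \<open>(x \<leadsto> y) \<sqinter> y = x \<leadsto> y\<close>. Since
  \<open>y \<leadsto> (x \<leadsto> y) = \<one>\<close>, every involutive BE algebra satisfies \<open>(x \<leadsto> y) \<sqinter> y = y\<close>,
  so that law fails already for \<open>x = y = \<zero>\<close> unless \<open>\<zero> = \<one>\<close>. The law is read here with
  \<open>\<squnion>\<close> in place of \<open>\<sqinter>\<close>, that is, \<open>(x \<leadsto> y) \<squnion> y = x \<leadsto> y\<close>.
\<close>

end

theory Submission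
  imports Defs
begin

text \<open>
  An involutive BE algebra carries a commutative product \<open>a \<odot> b = \<sim>(a \<leadsto> \<sim>b)\<close>, for which
  implication is the residual: \<open>(a \<odot> b) \<leadsto> c = a \<leadsto> (b \<leadsto> c)\<close>. In these terms
  \<open>x \<sqinter> y = y \<odot> (y \<leadsto> x)\<close>, and \<open>x \<preceq>\<^sub>Q y\<close> says that \<open>y\<close> divides \<open>x\<close> with quotient \<open>y \<leadsto> x\<close>.

  The implicative-orthomodular law says that \<open>x \<preceq>\<^sub>Q t \<leadsto> x\<close>. By contraposition it turns into
  the cancellation law \<open>(x \<leadsto> y) \<leadsto> (y \<sqinter> x) = x\<close>. Applied to \<open>x \<leadsto> y\<close> instead of \<open>x\<close>, this
  gives the absorption law \<open>x \<leadsto> (y \<sqinter> x) = x \<leadsto> y\<close>, whose dual for the join is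
  \<open>((x \<leadsto> y) \<leadsto> y) \<leadsto> y = x \<leadsto> y\<close>. The cancellation law also shows that the elements above \<open>x\<close>
  in the order \<open>\<preceq>\<^sub>Q\<close> are exactly those of the form \<open>t \<leadsto> x\<close>. As
  \<open>s \<leadsto> (t \<leadsto> x) = (s \<odot> t) \<leadsto> x\<close>, transitivity of \<open>\<preceq>\<^sub>Q\<close> follows at once, and the remaining
  claims about \<open>\<preceq>\<^sub>Q\<close> that use the orthomodular law come from writing elements in this form.
\<close>

context involutive_BE_algebra
begin

definition prod :: "'a \<Rightarrow> 'a \<Rightarrow> 'a"  (infixl \<open>\<odot>\<close> 70)
  where "a \<odot> b = \<sim>(a \<leadsto> \<sim>b)"

lemma neg_closed [simp]: "a \<in> carrier X \<Longrightarrow> \<sim>a \<in> carrier X"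
  by (simp add: neg_def imp_closed zero_closed)

lemma prod_closed [simp]: "\<lbrakk>a \<in> carrier X; b \<in> carrier X\<rbrakk> \<Longrightarrow> a \<odot> b \<in> carrier X"
  by (simp add: prod_def imp_closed)

lemma imp_neg_commute:
  "\<lbrakk>a \<in> carrier X; b \<in> carrier X\<rbrakk> \<Longrightarrow> a \<leadsto> \<sim>b = b \<leadsto> \<sim>a"
  by (simp add: neg_def exchange zero_closed)

lemma contraposition:
  assumes "a \<in> carrier X" "b \<in> carrier X"
  shows "\<sim>a \<leadsto> \<sim>b = b \<leadsto> a"
  using imp_neg_commute[of "\<sim>a" b] assms by (simp add: neg_neg)

lemma prod_commute: "\<lbrakk>a \<in> carrier X; b \<in> carrier X\<rbrakk> \<Longrightarrow> a \<odot> b = b \<odot> a"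
  by (simp add: prod_def imp_neg_commute)

lemma neg_prod: "\<lbrakk>a \<in> carrier X; b \<in> carrier X\<rbrakk> \<Longrightarrow> \<sim>(a \<odot> b) = a \<leadsto> \<sim>b"
  by (simp add: prod_def neg_neg imp_closed)

text \<open>
  Moving \<open>c\<close> to the left by contraposition makes the negations in the definition of the product
  cancel, so that the law reduces to exchange.
\<close>

lemma residuation:
  assumes [simp]: "a \<in> carrier X" "b \<in> carrier X" "c \<in> carrier X"
  shows "(a \<odot> b) \<leadsto> c = a \<leadsto> (b \<leadsto> c)"
proof -
  have "(a \<odot> b) \<leadsto> c = \<sim>c \<leadsto> \<sim>(a \<odot> b)"
    by (simp add: contraposition)
  also have "\<dots> = a \<leadsto> (\<sim>c \<leadsto> \<sim>b)"
    by (simp add: neg_prod exchange)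
  finally show ?thesis
    by (simp add: contraposition)
qed

lemma prod_assoc:
  assumes [simp]: "a \<in> carrier X" "b \<in> carrier X" "c \<in> carrier X"
  shows "(a \<odot> b) \<odot> c = a \<odot> (b \<odot> c)"
  using residuation[of a b "\<sim>c"] by (simp add: prod_def neg_neg imp_closed)

lemma prod_one: "a \<in> carrier X \<Longrightarrow> a \<odot> \<one> = a"
  using imp_neg_commute[of a \<one>] by (simp add: prod_def one_imp neg_neg one_closed)

lemma qmeet_eq_prod:
  assumes [simp]: "x \<in> carrier X" "y \<in> carrier X"
  shows "x \<sqinter> y = y \<odot> (y \<leadsto> x)"
  by (simp add: qmeet_def contraposition prod_def imp_closed imp_neg_commute[of y "y \<leadsto> x"])

lemma q_le_iff_prod:
  "\<lbrakk>x \<in> carrier X; y \<in> carrier X\<rbrakk> \<Longrightarrow> x \<preceq>\<^sub>Q y \<longleftrightarrow> y \<odot> (y \<leadsto> x) = x"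
  by (auto simp: q_le_def qmeet_eq_prod)

lemma q_le_antisym_le:
  assumes "x \<in> carrier X" "y \<in> carrier X" "x \<preceq>\<^sub>Q y" "y \<preceq> x"
  shows "x = y"
  using assms by (simp add: q_le_iff_prod be_le_def prod_one)

end

context implicative_orthomodular_algebra
begin

lemma q_le_imp: "\<lbrakk>x \<in> carrier X; t \<in> carrier X\<rbrakk> \<Longrightarrow> x \<preceq>\<^sub>Q t \<leadsto> x"
  by (simp add: q_le_def implicative_orthomodular)

lemma orthomodular_prod:
  "\<lbrakk>x \<in> carrier X; t \<in> carrier X\<rbrakk> \<Longrightarrow> (t \<leadsto> x) \<odot> ((t \<leadsto> x) \<leadsto> x) = x"
  using q_le_imp[of x t] by (simp add: q_le_iff_prod imp_closed)

text \<open>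
  Negating the orthomodular law for \<open>\<sim>x\<close> turns the product into an implication; its left side
  \<open>\<sim>y \<leadsto> \<sim>x\<close> is \<open>x \<leadsto> y\<close> again.
\<close>

lemma imp_qmeet_cancel:
  assumes [simp]: "x \<in> carrier X" "y \<in> carrier X"
  shows "(x \<leadsto> y) \<leadsto> (y \<sqinter> x) = x"
proof -
  have [simp]: "x \<leadsto> y \<in> carrier X" by (simp add: imp_closed)
  have "(x \<leadsto> y) \<odot> ((x \<leadsto> y) \<leadsto> \<sim>x) = \<sim>x"
    using orthomodular_prod[of "\<sim>x" "\<sim>y"] by (simp add: contraposition)
  then have "\<sim>((x \<leadsto> y) \<odot> ((x \<leadsto> y) \<leadsto> \<sim>x)) = x"
    by (simp add: neg_neg)
  moreover have "\<sim>((x \<leadsto> y) \<odot> ((x \<leadsto> y) \<leadsto> \<sim>x)) = (x \<leadsto> y) \<leadsto> ((x \<leadsto> y) \<odot> x)"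
    by (simp add: neg_prod imp_closed prod_def neg_neg)
  ultimately show ?thesis
    by (simp add: qmeet_eq_prod prod_commute)
qed

text \<open>
  Cancellation is used twice: once for \<open>x\<close> and \<open>y\<close>, and once for \<open>x \<leadsto> y\<close> and \<open>\<sim>x\<close>. In
  the second instance \<open>(x \<leadsto> y) \<leadsto> \<sim>x = \<sim>(y \<sqinter> x)\<close> by the definition of the product, and the first
  instance, negated, evaluates the meet \<open>\<sim>x \<sqinter> (x \<leadsto> y)\<close> to \<open>\<sim>x\<close>.
\<close>

lemma imp_qmeet_absorb:
  assumes [simp]: "x \<in> carrier X" "y \<in> carrier X"
  shows "x \<leadsto> (y \<sqinter> x) = x \<leadsto> y"
proof -
  define m where "m = y \<sqinter> x"
  have m: "m = x \<odot> (x \<leadsto> y)"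
    by (simp add: m_def qmeet_eq_prod)
  have [simp]: "x \<leadsto> y \<in> carrier X" "m \<in> carrier X"
    by (simp_all add: m imp_closed)
  have neg_m: "(x \<leadsto> y) \<leadsto> \<sim>x = \<sim>m"
    by (simp add: m neg_prod imp_neg_commute)
  have "\<sim>x \<sqinter> (x \<leadsto> y) = (x \<leadsto> y) \<odot> \<sim>m"
    by (simp add: qmeet_eq_prod neg_m)
  also have "\<dots> = \<sim>x"
    using imp_qmeet_cancel[of x y] by (simp add: prod_def neg_neg m_def[symmetric])
  finally have "\<sim>m \<leadsto> \<sim>x = x \<leadsto> y"
    using imp_qmeet_cancel[of "x \<leadsto> y" "\<sim>x"] by (simp add: neg_m)
  then show ?thesis
    by (simp add: contraposition m_def[symmetric])
qed

text \<open>
  As \<open>\<sim>x \<sqinter> \<sim>y = \<sim>(x \<squnion> y)\<close>, this is the contrapositive form of the absorption law for \<open>\<sqinter>\<close>.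
\<close>

lemma qjoin_imp_absorb:
  assumes [simp]: "x \<in> carrier X" "y \<in> carrier X"
  shows "(x \<squnion> y) \<leadsto> y = x \<leadsto> y"
proof -
  have [simp]: "x \<squnion> y \<in> carrier X" by (simp add: qjoin_def imp_closed)
  have "\<sim>x \<sqinter> \<sim>y = \<sim>(x \<squnion> y)"
    by (simp add: qmeet_def qjoin_def neg_neg)
  then show ?thesis
    using imp_qmeet_absorb[of "\<sim>y" "\<sim>x"] by (simp add: contraposition)
qed

text \<open>
  If \<open>x \<preceq>\<^sub>Q y\<close>, then \<open>x \<sqinter> y = x\<close> and cancellation gives \<open>y = (y \<leadsto> x) \<leadsto> x\<close>, so \<open>t = y \<leadsto> x\<close>
  is a witness.
\<close>

lemma q_le_iff_imp:
  assumes [simp]: "x \<in> carrier X" "y \<in> carrier X"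
  shows "x \<preceq>\<^sub>Q y \<longleftrightarrow> (\<exists>t \<in> carrier X. y = t \<leadsto> x)"
proof
  assume "x \<preceq>\<^sub>Q y"
  then have "y = (y \<leadsto> x) \<leadsto> x"
    using imp_qmeet_cancel[of y x] by (simp add: q_le_def)
  then show "\<exists>t \<in> carrier X. y = t \<leadsto> x"
    by (metis imp_closed assms)
qed (auto simp: q_le_imp)

lemma q_le_trans:
  assumes [simp]: "x \<in> carrier X" "y \<in> carrier X" "z \<in> carrier X"
    and "x \<preceq>\<^sub>Q y" "y \<preceq>\<^sub>Q z"
  shows "x \<preceq>\<^sub>Q z"
proof -
  obtain s t where [simp]: "s \<in> carrier X" "t \<in> carrier X" and "y = t \<leadsto> x" "z = s \<leadsto> y"
    using assms by (auto simp: q_le_iff_imp)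
  then have "z = (s \<odot> t) \<leadsto> x"
    by (simp add: residuation)
  then show ?thesis
    by (simp add: q_le_imp)
qed

lemma qmeet_q_le_right:
  assumes [simp]: "x \<in> carrier X" "y \<in> carrier X"
  shows "x \<sqinter> y \<preceq>\<^sub>Q y"
proof -
  have "x \<sqinter> y \<in> carrier X" by (simp add: qmeet_eq_prod imp_closed)
  then show ?thesis
    by (simp add: q_le_iff_prod imp_qmeet_absorb) (simp add: qmeet_eq_prod)
qed

text \<open>
  By residuation and associativity of the product, \<open>x \<sqinter> (u \<sqinter> v)\<close> is \<open>v\<close> times
  \<open>(v \<leadsto> x) \<sqinter> (v \<leadsto> u)\<close>. For \<open>u = t \<leadsto> x\<close>, exchange gives \<open>v \<leadsto> u = t \<leadsto> (v \<leadsto> x)\<close>, so the second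
  factor collapses to \<open>v \<leadsto> x\<close>, and \<open>v \<odot> (v \<leadsto> x) = x\<close> because \<open>x \<preceq>\<^sub>Q v\<close>.
\<close>

lemma q_le_qmeetI:
  assumes [simp]: "x \<in> carrier X" "u \<in> carrier X" "v \<in> carrier X"
    and "x \<preceq>\<^sub>Q u" "x \<preceq>\<^sub>Q v"
  shows "x \<preceq>\<^sub>Q u \<sqinter> v"
proof -
  obtain t where [simp]: "t \<in> carrier X" and u: "u = t \<leadsto> x"
    using assms by (auto simp: q_le_iff_imp)
  have [simp]: "v \<leadsto> x \<in> carrier X" "v \<leadsto> u \<in> carrier X"
    by (simp_all add: imp_closed)
  have "v \<leadsto> u = t \<leadsto> (v \<leadsto> x)"
    by (simp add: u exchange)
  then have collapse: "(v \<leadsto> u) \<odot> ((v \<leadsto> u) \<leadsto> (v \<leadsto> x)) = v \<leadsto> x"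
    by (simp add: orthomodular_prod)
  have "(v \<odot> (v \<leadsto> u)) \<leadsto> x = (v \<leadsto> u) \<leadsto> (v \<leadsto> x)"
    by (simp add: residuation exchange)
  then have "(u \<sqinter> v) \<odot> ((u \<sqinter> v) \<leadsto> x) = v \<odot> (v \<leadsto> x)"
    by (simp add: qmeet_eq_prod prod_assoc imp_closed collapse)
  also have "\<dots> = x"
    using \<open>x \<preceq>\<^sub>Q v\<close> by (simp add: q_le_iff_prod)
  finally show ?thesis
    by (simp add: q_le_iff_prod qmeet_eq_prod)
qed

lemma le_iff_qmeet:
  assumes [simp]: "x \<in> carrier X" "y \<in> carrier X"
  shows "x \<preceq> y \<longleftrightarrow> y \<sqinter> x = x"
proof
  assume "x \<preceq> y"
  then show "y \<sqinter> x = x"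
    by (simp add: be_le_def qmeet_eq_prod prod_one)
next
  assume "y \<sqinter> x = x"
  then show "x \<preceq> y"
    using imp_qmeet_absorb[of x y] by (simp add: be_le_def imp_self)
qed

lemma qmeet_q_le_imp:
  assumes [simp]: "x \<in> carrier X" "y \<in> carrier X"
  shows "x \<sqinter> y \<preceq>\<^sub>Q x \<leadsto> y" and "y \<sqinter> x \<preceq>\<^sub>Q x \<leadsto> y"
proof -
  have [simp]: "x \<sqinter> y \<in> carrier X" "y \<sqinter> x \<in> carrier X"
    by (simp_all add: qmeet_eq_prod imp_closed)
  show "x \<sqinter> y \<preceq>\<^sub>Q x \<leadsto> y"
    by (rule q_le_trans[of _ y]) (simp_all add: imp_closed qmeet_q_le_right q_le_imp)
  show "y \<sqinter> x \<preceq>\<^sub>Q x \<leadsto> y"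
    using q_le_imp[of "y \<sqinter> x" x] by (simp add: imp_qmeet_absorb)
qed

end

theorem proposition3p6:
  fixes X (structure)
  assumes "implicative_orthomodular_algebra X"
    and "x \<in> carrier X" and "y \<in> carrier X" and "z \<in> carrier X"
  shows "((x \<leadsto> y) \<squnion> y = x \<leadsto> y) \<and>
    ((x \<leadsto> y) \<leadsto> (y \<sqinter> x) = x) \<and>
    (x \<leadsto> (y \<sqinter> x) = x \<leadsto> y) \<and>
    ((x \<squnion> y) \<leadsto> \<sim>(x \<leadsto> y) = \<sim>y) \<and>
    (x \<sqinter> ((y \<leadsto> x) \<sqinter> (z \<leadsto> x)) = x) \<and>
    (x \<preceq> y \<longleftrightarrow> y \<sqinter> x = x) \<and>
    (x \<preceq>\<^sub>Q y \<and> y \<preceq> x \<longrightarrow> x = y) \<and>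
    (x \<sqinter> y \<preceq>\<^sub>Q y \<and> y \<preceq>\<^sub>Q x \<squnion> y) \<and>
    ((x \<squnion> y) \<leadsto> y = x \<leadsto> y) \<and>
    (x \<sqinter> y \<preceq>\<^sub>Q x \<leadsto> y \<and> y \<sqinter> x \<preceq>\<^sub>Q x \<leadsto> y)"
proof -
  interpret implicative_orthomodular_algebra X by fact
  note [simp] = assms(2-4)
  have [simp]: "x \<leadsto> y \<in> carrier X" "x \<squnion> y \<in> carrier X" "y \<leadsto> x \<in> carrier X" "z \<leadsto> x \<in> carrier X"
    by (simp_all add: qjoin_def imp_closed)
  have "(x \<leadsto> y) \<squnion> y = (x \<squnion> y) \<leadsto> y"
    by (simp add: qjoin_def)
  then have join_imp: "(x \<leadsto> y) \<squnion> y = x \<leadsto> y"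
    by (simp add: qjoin_imp_absorb)
  \<comment> \<open>The implication is the negated product of \<open>x \<leadsto> y\<close> and \<open>x \<squnion> y = (x \<leadsto> y) \<leadsto> y\<close>,
    which is \<open>y\<close> by the orthomodular law.\<close>
  have "(x \<squnion> y) \<leadsto> \<sim>(x \<leadsto> y) = \<sim>((x \<leadsto> y) \<odot> (x \<squnion> y))"
    by (simp add: neg_prod imp_neg_commute)
  also have "\<dots> = \<sim>y"
    by (simp add: qjoin_def orthomodular_prod)
  finally have join_imp_neg: "(x \<squnion> y) \<leadsto> \<sim>(x \<leadsto> y) = \<sim>y" .
  have "x \<preceq>\<^sub>Q (y \<leadsto> x) \<sqinter> (z \<leadsto> x)"
    by (simp add: q_le_qmeetI q_le_imp)
  then have meet_meet: "x \<sqinter> ((y \<leadsto> x) \<sqinter> (z \<leadsto> x)) = x"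
    by (simp add: q_le_def)
  have "y \<preceq>\<^sub>Q x \<squnion> y"
    by (simp add: qjoin_def q_le_imp)
  then show ?thesis
    using join_imp join_imp_neg meet_meet q_le_antisym_le[of x y]
    by (simp add: imp_qmeet_cancel imp_qmeet_absorb le_iff_qmeet qmeet_q_le_right
        qjoin_imp_absorb qmeet_q_le_imp)
qed

end
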